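(* Let $q$ be even and let $m,k$ be positive integers with $m>(k+1)/2$. Then $\mathbb{F}_q^{4mk}$, equipped with a suitable nondegenerate quadratic form of plus type, has a set $\Sigma$ of $q^{2mk-k}+1$ totally singular $2mk$-dimensional subspaces pairwise intersecting in $0$ such that $\Sigma$ is a maximal partial spread (every $2mk$-dimensional $\mathbb{F}_q$-subspace meets some member of $\Sigma$ nontrivially). In particular $\Sigma$ is an orthogonal partial spread and also a symplectic partial spread (with respect to the polar alternating form).
   Context: A partial spread of a $2n$-dimensional space is a set of $n$-dimensional subspaces pairwise meeting only in $0$. For a quadratic form $Q$, a subspace is totally singular if $Q$ vanishes on it; for $q$ even the polar form $f(u,v)=Q(u+v)-Q(u)-Q(v)$ is alternating and totally singular subspaces are totally isotropic. An orthogonal (resp. symplectic) partial spread is a partial spread of totally singular (resp. totally isotropic) subspaces. *)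

theory Defs
  imports "HOL-Analysis.Analysis"
begin

definition bilinear_form :: "('a::field ^ 'n \<Rightarrow> 'a ^ 'n \<Rightarrow> 'a) \<Rightarrow> bool" where
  "bilinear_form f \<longleftrightarrow>
     (\<forall>u. Vector_Spaces.linear (*s) (*) (\<lambda>v. f u v)) \<and>
     (\<forall>v. Vector_Spaces.linear (*s) (*) (\<lambda>u. f u v))"

definition alternating_form :: "('a::field ^ 'n \<Rightarrow> 'a ^ 'n \<Rightarrow> 'a) \<Rightarrow> bool" where
  "alternating_form f \<longleftrightarrow> bilinear_form f \<and> (\<forall>v. f v v = 0)"

definition symplectic_form :: "('a::field ^ 'n \<Rightarrow> 'a ^ 'n \<Rightarrow> 'a) \<Rightarrow> bool" where
  "symplectic_form f \<longleftrightarrow> alternating_form f \<and> (\<forall>u. (\<forall>v. f u v = 0) \<longrightarrow> u = 0)"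

definition polar_form :: "('a::field ^ 'n \<Rightarrow> 'a) \<Rightarrow> 'a ^ 'n \<Rightarrow> 'a ^ 'n \<Rightarrow> 'a" where
  "polar_form Q u v = Q (u + v) - Q u - Q v"

definition quadratic_form :: "('a::field ^ 'n \<Rightarrow> 'a) \<Rightarrow> bool" where
  "quadratic_form Q \<longleftrightarrow> (\<forall>c v. Q (c *s v) = c\<^sup>2 * Q v) \<and> bilinear_form (polar_form Q)"

(* The definition valid in every characteristic: no nonzero singular vector lies in the
   radical of the polar form.  Over a finite field of even order and in even dimension
   this forces the polar form itself to be nondegenerate. *)
definition nondegenerate_quadratic_form :: "('a::field ^ 'n \<Rightarrow> 'a) \<Rightarrow> bool" where
  "nondegenerate_quadratic_form Q \<longleftrightarrow>
     quadratic_form Q \<and> (\<forall>u. Q u = 0 \<and> (\<forall>v. polar_form Q u v = 0) \<longrightarrow> u = 0)"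

definition totally_singular :: "('a::field ^ 'n \<Rightarrow> 'a) \<Rightarrow> ('a ^ 'n) set \<Rightarrow> bool" where
  "totally_singular Q U \<longleftrightarrow> vec.subspace U \<and> (\<forall>u\<in>U. Q u = 0)"

definition totally_isotropic ::
    "('a::field ^ 'n \<Rightarrow> 'a ^ 'n \<Rightarrow> 'a) \<Rightarrow> ('a ^ 'n) set \<Rightarrow> bool" where
  "totally_isotropic f U \<longleftrightarrow> vec.subspace U \<and> (\<forall>u\<in>U. \<forall>v\<in>U. f u v = 0)"

definition witt_index :: "('a::field ^ 'n::finite \<Rightarrow> 'a) \<Rightarrow> nat" where
  "witt_index Q = Max {vec.dim U | U. totally_singular Q U}"

(* Plus type: the Witt index is half the dimension, the largest possible value. *)
definition plus_type :: "('a::field ^ 'n::finite \<Rightarrow> 'a) \<Rightarrow> bool" where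
  "plus_type Q \<longleftrightarrow> nondegenerate_quadratic_form Q \<and> 2 * witt_index Q = CARD('n)"

definition half_dim_subspace :: "('a::field ^ 'n::finite) set \<Rightarrow> bool" where
  "half_dim_subspace U \<longleftrightarrow> vec.subspace U \<and> 2 * vec.dim U = CARD('n)"

definition partial_spread :: "('a::field ^ 'n::finite) set set \<Rightarrow> bool" where
  "partial_spread S \<longleftrightarrow>
     (\<forall>U\<in>S. half_dim_subspace U) \<and> (\<forall>U\<in>S. \<forall>W\<in>S. U \<noteq> W \<longrightarrow> U \<inter> W = {0})"

definition maximal_partial_spread :: "('a::field ^ 'n::finite) set set \<Rightarrow> bool" where
  "maximal_partial_spread S \<longleftrightarrow>
     partial_spread S \<and> (\<forall>W. half_dim_subspace W \<longrightarrow> (\<exists>U\<in>S. U \<inter> W \<noteq> {0}))"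

definition orthogonal_partial_spread ::
    "('a::field ^ 'n::finite \<Rightarrow> 'a) \<Rightarrow> ('a ^ 'n) set set \<Rightarrow> bool" where
  "orthogonal_partial_spread Q S \<longleftrightarrow>
     nondegenerate_quadratic_form Q \<and> partial_spread S \<and> (\<forall>U\<in>S. totally_singular Q U)"

definition symplectic_partial_spread ::
    "('a::field ^ 'n::finite \<Rightarrow> 'a ^ 'n \<Rightarrow> 'a) \<Rightarrow> ('a ^ 'n) set set \<Rightarrow> bool" where
  "symplectic_partial_spread f S \<longleftrightarrow>
     symplectic_form f \<and> partial_spread S \<and> (\<forall>U\<in>S. totally_isotropic f U)"

end

theory Submission
  imports Defs "HOL-Algebra.Algebraic_Closure_Type"
begin

text \<open>Let \<open>r = q\<^sup>k\<close> and \<open>n = 2m - 1\<close>. Inside an algebraic closure of the field of order \<open>q\<close> take the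
  fields \<open>K\<close> and \<open>L\<close> of orders \<open>r\<close> and \<open>r\<^sup>n\<close>, with trace \<open>T : L \<rightarrow> K\<close>. The desarguesian orthogonal
  spread of the quadratic form \<open>T (x y) + a b\<close> on \<open>L \<times> K \<times> L \<times> K\<close> has \<open>r\<^sup>n + 1\<close> members and they
  cover all singular vectors. Composing the form with the trace from \<open>K\<close> to the field of order
  \<open>q\<close> keeps the members totally singular. The original form amounts to \<open>k\<close> quadratic forms in
  \<open>4mk\<close> variables, so, as \<open>m > 1\<close>, the Chevalley--Warning theorem provides a common nontrivial
  zero on every subspace of dimension \<open>2mk\<close>; being singular, this zero lies in some member.\<close>

section \<open>Additive maps on elementary abelian 2-groups\<close>

definition add_closed :: "'v::ab_group_add set \<Rightarrow> bool" where
  "add_closed G \<longleftrightarrow> 0 \<in> G \<and> (\<forall>x\<in>G. \<forall>y\<in>G. x + y \<in> G)"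

lemma add_closedI:
  "0 \<in> G \<Longrightarrow> (\<And>x y. x \<in> G \<Longrightarrow> y \<in> G \<Longrightarrow> x + y \<in> G) \<Longrightarrow> add_closed G"
  by (simp add: add_closed_def)

text \<open>A maximal proper subgroup \<open>H\<close> works: for \<open>w\<close> in
  \<open>G\<close> outside \<open>H\<close>, the union of \<open>H\<close> and its translate is
  closed because \<open>w + w = 0\<close>, so maximality makes it all of \<open>G\<close>. This
  splitting drives the inductions on \<open>card G\<close> below.\<close>

lemma add_closed_index_two:
  fixes G :: "'v::ab_group_add set"
  assumes char2: "\<And>x::'v. x + x = 0"
    and "finite G" "add_closed G" "G \<noteq> {0}"
  obtains H w where "add_closed H" "w \<notin> H" "H \<union> (+) w ` H = G" "H \<inter> (+) w ` H = {}"
proof -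
  define \<H> where "\<H> = {H. add_closed H \<and> H \<subset> G}"
  have "finite \<H>"
    by (rule finite_subset[of _ "Pow G"]) (use assms in \<open>auto simp: \<H>_def\<close>)
  moreover have "{0} \<in> \<H>"
    using assms by (auto simp: \<H>_def add_closed_def)
  ultimately obtain H where H: "H \<in> \<H>" and max: "\<And>H'. H' \<in> \<H> \<Longrightarrow> H \<subseteq> H' \<Longrightarrow> H = H'"
    using finite_has_maximal[of \<H>] by blast
  then obtain w where w: "w \<in> G" "w \<notin> H"
    by (auto simp: \<H>_def)
  have Hc: "add_closed H" "H \<subset> G"
    using H by (auto simp: \<H>_def)
  have ww: "w + x + (w + y) = x + y" for x y
    using char2[of w] by (metis add.assoc add.commute add_0)
  have "add_closed (H \<union> (+) w ` H)"
  proof (rule add_closedI)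
    fix x y assume "x \<in> H \<union> (+) w ` H" "y \<in> H \<union> (+) w ` H"
    then show "x + y \<in> H \<union> (+) w ` H"
      using Hc(1) ww unfolding add_closed_def
      by (auto simp: image_iff add.assoc add.left_commute; metis add.commute add.left_commute)
  qed (use Hc in \<open>auto simp: add_closed_def\<close>)
  moreover have "H \<union> (+) w ` H \<subseteq> G"
    using Hc w assms by (auto simp: add_closed_def)
  moreover have "w \<in> H \<union> (+) w ` H"
    using Hc by (auto simp: add_closed_def image_iff)
  ultimately have eq: "H \<union> (+) w ` H = G"
    using max[of "H \<union> (+) w ` H"] w by (auto simp: \<H>_def)
  have "H \<inter> (+) w ` H = {}"
  proof (rule ccontr)
    assume "H \<inter> (+) w ` H \<noteq> {}"
    then obtain h where "h \<in> H" "w + h \<in> H" by auto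
    then have "(w + h) + h \<in> H"
      using Hc by (auto simp: add_closed_def)
    then show False
      using char2[of h] w by (simp add: add.assoc)
  qed
  then show ?thesis
    using that Hc w eq by blast
qed

lemma card_add_closed_power_two:
  fixes G :: "'v::ab_group_add set"
  assumes char2: "\<And>x::'v. x + x = 0" and "finite G" "add_closed G"
  shows "\<exists>e. card G = 2 ^ e"
  using assms(2,3)
proof (induction "card G" arbitrary: G rule: less_induct)
  case less
  show ?case
  proof (cases "G = {0}")
    case True
    then show ?thesis by (intro exI[of _ 0]) auto
  next
    case False
    from add_closed_index_two[OF char2 less.prems False] obtain H w
      where H: "add_closed H" "w \<notin> H" "H \<union> (+) w ` H = G" "H \<inter> (+) w ` H = {}"
      by blast
    have fin: "finite H" using H less.prems by (metis finite_Un)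
    have card: "card G = 2 * card H"
      using H fin card_Un_disjoint[of H "(+) w ` H"] by (simp add: card_image)
    have "card H > 0"
      using H fin by (auto simp: add_closed_def card_gt_0_iff)
    then obtain e where "card H = 2 ^ e"
      using less.hyps[of H] card fin H by auto
    then show ?thesis
      using card by (intro exI[of _ "Suc e"]) auto
  qed
qed

text \<open>Over the field of two elements this is the key step of the Chevalley--Warning theorem:
  a polynomial function sums to zero over a space whose dimension exceeds its degree.\<close>

lemma sum_prod_additive_eq_0:
  fixes G :: "'v::ab_group_add set" and g :: "'i \<Rightarrow> 'v \<Rightarrow> 'c::comm_ring_1"
  assumes char2: "\<And>x::'v. x + x = 0" "(2::'c) = 0"
    and additive: "\<And>i x y. i \<in> I \<Longrightarrow> g i (x + y) = g i x + g i y"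
    and "finite G" "add_closed G" "finite I" "2 ^ card I < card G"
  shows "(\<Sum>x\<in>G. \<Prod>i\<in>I. g i x) = 0"
  using assms(3-)
proof (induction "card G" arbitrary: G I rule: less_induct)
  case less
  have "G \<noteq> {0}"
    using less.prems(5) by auto
  from add_closed_index_two[OF char2(1) less.prems(2,3) this] obtain H w
    where H: "add_closed H" "w \<notin> H" "H \<union> (+) w ` H = G" "H \<inter> (+) w ` H = {}"
    by blast
  have fin: "finite H" using H less.prems(2) by (metis finite_Un)
  have card: "card G = 2 * card H"
    using H fin card_Un_disjoint[of H "(+) w ` H"] by (simp add: card_image)
  have pos: "card H > 0"
    using H fin by (auto simp: add_closed_def card_gt_0_iff)
  \<comment> \<open>\<open>H\<close> has half the size of \<open>G\<close>, but dropping a factor at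
    least halves \<open>2 ^ card I\<close>, so the size bound survives and the induction hypothesis
    applies.\<close>
  have sub: "(\<Sum>x\<in>H. \<Prod>i\<in>J. g i x) = 0" if "J \<subset> I" for J
  proof -
    have "card J < card I"
      using that less.prems(4) by (simp add: psubset_card_mono)
    then have "2 * 2 ^ card J \<le> (2::nat) ^ card I"
      by (metis Suc_leI power_Suc power_increasing one_le_numeral)
    then have "2 ^ card J < card H"
      using less.prems(5) card by linarith
    moreover have "finite J"
      using that less.prems(4) finite_subset by blast
    ultimately show ?thesis
      using card pos H fin less.prems(1) that by (intro less.hyps[of H J]) auto
  qed
  have "(\<Sum>x\<in>G. \<Prod>i\<in>I. g i x)
      = (\<Sum>x\<in>H. \<Prod>i\<in>I. g i x) + (\<Sum>x\<in>H. \<Prod>i\<in>I. g i (w + x))"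
    using H fin by (subst H(3)[symmetric], subst sum.union_disjoint) (auto simp: sum.reindex)
  also have "(\<Sum>x\<in>H. \<Prod>i\<in>I. g i (w + x)) = (\<Sum>x\<in>H. \<Prod>i\<in>I. g i x + g i w)"
    using less.prems(1) by (intro sum.cong prod.cong) (auto simp: add.commute)
  also have "\<dots> = (\<Sum>J\<in>Pow I. (\<Sum>x\<in>H. \<Prod>i\<in>J. g i x) * (\<Prod>i\<in>I-J. g i w))"
    using less.prems(4) by (subst sum_distrib_right, subst sum.swap) (simp add: prod_add)
  \<comment> \<open>Only \<open>J = I\<close> survives; its term repeats the sum over
    \<open>H\<close>, so the total is twice that sum.\<close>
  also have "\<dots> = (\<Sum>J\<in>{I}. (\<Sum>x\<in>H. \<Prod>i\<in>J. g i x) * (\<Prod>i\<in>I-J. g i w))"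
    using less.prems(4) by (intro sum.mono_neutral_right) (auto simp: sub psubset_eq)
  also have "(\<Sum>x\<in>H. \<Prod>i\<in>I. g i x) + \<dots> = 2 * (\<Sum>x\<in>H. \<Prod>i\<in>I. g i x)"
    by simp
  finally show ?case
    using char2(2) by simp
qed

section \<open>Finite fields of even order\<close>

text \<open>Multiplication by a nonzero \<open>x\<close> permutes the nonzero elements, so their
  product does not change. Comparing the two products, each multiplied once more by
  \<open>x\<close>, gives the claim.\<close>

lemma finite_field_power_card:
  fixes x :: "'a::{field,finite}"
  shows "x ^ CARD('a) = x"
proof (cases "x = 0")
  case False
  have "x * (\<Prod>y\<in>UNIV-{0}. x * y) = (x ^ (CARD('a) - 1) * x) * \<Prod>(UNIV-{0})"
    by (simp add: prod.distrib mult_ac)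
  moreover have "x ^ (CARD('a) - 1) * x = x ^ CARD('a)"
    by (rule power_minus_mult) simp
  moreover have "(\<Prod>y\<in>UNIV-{0}. x * y) = (\<Prod>y\<in>UNIV-{0}. y)"
    by (rule prod.reindex_bij_witness[of _ "\<lambda>y. y / x" "\<lambda>y. x * y"]) (use False in auto)
  ultimately have "x * \<Prod>(UNIV-{0}) = x ^ CARD('a) * \<Prod>(UNIV-{0})"
    by (simp only:)
  then show ?thesis
    by simp
qed (use finite_UNIV_card_ge_0[where ?'a = 'a] in auto)

lemma even_card_field:
  assumes "even CARD('a::{field,finite})"
  shows "CHAR('a) = 2" "\<exists>e>0. CARD('a) = 2 ^ e"
proof -
  \<comment> \<open>With an even exponent the left side is \<open>1\<close>, which forces
    characteristic 2.\<close>
  have "(-1) ^ CARD('a) = (-1::'a)"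
    by (rule finite_field_power_card)
  then have "(-1::'a) = 1"
    using assms by simp
  then have two: "(2::'a) = 0"
    by (metis add.right_inverse one_add_one)
  then show "CHAR('a) = 2"
    by (intro CHAR_eq_posI) (auto simp: less_2_cases_iff)
  have "x + x = 0" for x :: 'a
    using two by (metis mult_2 mult_zero_left)
  then obtain e where e: "CARD('a) = 2 ^ e"
    using card_add_closed_power_two[of "UNIV :: 'a set"] by (auto simp: add_closed_def)
  moreover have "e > 0"
    using e assms by (cases e) auto
  ultimately show "\<exists>e>0. CARD('a) = 2 ^ e"
    by blast
qed

text \<open>The polynomial \<open>X ^ N - X\<close> splits, and its derivative is the constant
  \<open>-1\<close> because \<open>N\<close> vanishes in the field. Hence no root is repeated, and
  the number of roots is the degree.\<close>

lemma card_power_fixed_points: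
  fixes N :: nat
  assumes "CHAR('c::alg_closed_field) dvd N" "N > 1"
  shows "finite {x::'c. x ^ N = x}" "card {x::'c. x ^ N = x} = N"
proof -
  define p :: "'c poly" where "p = Polynomial.monom 1 N - Polynomial.monom 1 1"
  have deg: "Polynomial.degree p = N"
    unfolding p_def using assms(2)
    by (simp add: degree_monom_eq diff_conv_add_uminus degree_add_eq_left del: add_uminus_conv_diff)
  then have p0: "p \<noteq> 0"
    using assms(2) by auto
  have root: "poly p x = 0 \<longleftrightarrow> x ^ N = x" for x
    by (simp add: p_def poly_monom)
  have "of_nat N = (0::'c)"
    using assms(1) of_nat_eq_0_iff_char_dvd by blast
  then have pderiv: "pderiv p = - 1"
    by (simp add: p_def pderiv_diff pderiv_monom)
  obtain A where A: "size A = N" "p = Polynomial.smult (Polynomial.lead_coeff p) (\<Prod>x\<in>#A. [:-x, 1:])"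
    using alg_closed_imp_factorization[OF p0] deg by auto
  have roots: "set_mset A = {x. x ^ N = x}"
  proof -
    have "poly (\<Prod>x\<in>#A. [:-x, 1:]) z = 0 \<longleftrightarrow> z \<in># A" for z
      by (induction A) auto
    then have "poly p z = 0 \<longleftrightarrow> z \<in># A" for z
      by (subst A(2)) (simp add: p0)
    then show ?thesis
      using root by auto
  qed
  have "count A a = 1" if "a \<in># A" for a
  proof (rule ccontr)
    assume "count A a \<noteq> 1"
    moreover have "count A a > 0"
      using that by simp
    ultimately have "count A a \<ge> 2"
      by linarith
    then have "a \<in># A - {#a#}"
      by (simp flip: count_greater_zero_iff)
    then obtain B where B: "A = add_mset a (add_mset a B)"
      using multi_member_split[of a "A - {#a#}"] insert_DiffM[OF \<open>a \<in># A\<close>] by auto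
    define s where "s = Polynomial.smult (Polynomial.lead_coeff p) (\<Prod>x\<in>#B. [:-x, 1:])"
    have "p = [:-a,1:] * ([:-a,1:] * s)"
      by (subst A(2)) (simp only: B s_def image_mset_add_mset prod_mset.add_mset mult_smult_right)
    then have "poly (pderiv p) a = 0"
      by (simp only: pderiv_mult) simp
    then show False
      by (simp add: pderiv)
  qed
  then have "card (set_mset A) = size A"
    by (simp add: size_multiset_overloaded_eq)
  then show "finite {x::'c. x ^ N = x}" "card {x::'c. x ^ N = x} = N"
    using A(1) roots finite_set_mset[of A] by simp_all
qed

text \<open>In an algebraically closed field of characteristic 2, for \<open>N > 1\<close> a power
  of 2, this is the subfield of order \<open>N\<close>. Keeping subfields as sets lets the whole
  tower live in one type.\<close>

definition fixed_field :: "nat \<Rightarrow> 'c::field set" where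
  "fixed_field N = {x. x ^ N = x}"

text \<open>On \<open>fixed_field (r ^ n)\<close> this is the trace to \<open>fixed_field r\<close>,
  written as the sum of the Frobenius conjugates. As a polynomial function it makes sense
  everywhere, so its zeros can be counted.\<close>

definition rel_trace :: "nat \<Rightarrow> nat \<Rightarrow> 'c::field \<Rightarrow> 'c" where
  "rel_trace r n x = (\<Sum>i<n. x ^ (r ^ i))"

lemma char2_simps:
  assumes "CHAR('c::field) = 2"
  shows "(2::'c) = 0" "x + x = (0::'c)" "- x = (x::'c)" "x - y = x + (y::'c)"
    and "x + y = 0 \<longleftrightarrow> x = (y::'c)"
proof -
  show two: "(2::'c) = 0"
    using assms by (metis of_nat_CHAR of_nat_numeral)
  then show *: "x + x = 0" for x :: 'c
    by (metis mult_2 mult_zero_left)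
  show **: "- x = x" for x :: 'c
    using *[of x] by (metis add_eq_0_iff)
  show "x - y = x + y" "x + y = 0 \<longleftrightarrow> x = y"
    using **[of y] by (metis diff_conv_add_uminus, metis add_eq_0_iff **)
qed

lemma power_two_power_add:
  assumes "CHAR('c::field) = 2"
  shows "(x + y :: 'c) ^ (2 ^ e) = x ^ (2 ^ e) + y ^ (2 ^ e)"
  by (rule freshmans_dream') (simp_all add: assms)

lemma power_two_power_sum:
  assumes "CHAR('c::field) = 2"
  shows "(\<Sum>i\<in>A. f i :: 'c) ^ (2 ^ e) = (\<Sum>i\<in>A. f i ^ (2 ^ e))"
  by (rule freshmans_dream_sum') (simp_all add: assms)

lemma fixed_field_0 [simp]: "0 < N \<Longrightarrow> 0 \<in> fixed_field N"
  and fixed_field_mult: "x \<in> fixed_field N \<Longrightarrow> y \<in> fixed_field N \<Longrightarrow> x * y \<in> fixed_field N"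
  and fixed_field_divide: "x \<in> fixed_field N \<Longrightarrow> y \<in> fixed_field N \<Longrightarrow> x / y \<in> fixed_field N"
  by (auto simp: fixed_field_def power_mult_distrib power_divide)

lemma fixed_field_add:
  assumes "CHAR('c::field) = 2" "x \<in> fixed_field (2 ^ e)" "(y::'c) \<in> fixed_field (2 ^ e)"
  shows "x + y \<in> fixed_field (2 ^ e)"
  using assms by (simp add: fixed_field_def power_two_power_add)

lemma power_power_fixed:
  assumes "x \<in> fixed_field r" shows "x ^ (r ^ i) = x"
  using assms by (induction i) (auto simp: fixed_field_def power_mult)

lemma fixed_field_mono: "fixed_field r \<subseteq> fixed_field (r ^ n)"
  using power_power_fixed by (auto simp: fixed_field_def)

lemma rel_trace_0 [simp]: "r > 0 \<Longrightarrow> rel_trace r n 0 = 0"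
  by (auto simp: rel_trace_def power_0_left intro!: sum.neutral)

lemma rel_trace_smult:
  assumes "c \<in> fixed_field r" shows "rel_trace r n (c * x) = c * rel_trace r n x"
  using power_power_fixed[OF assms]
  by (simp add: rel_trace_def power_mult_distrib sum_distrib_left)

text \<open>The trace is a polynomial function with distinct exponents, the largest being
  \<open>r ^ (n - 1)\<close>, so the polynomial is nonzero and its degree bounds the number of
  roots.\<close>

lemma rel_trace_card_roots:
  assumes "r > 1" "n > 0"
  shows "finite {x::'c::field. rel_trace r n x = 0}"
    and "card {x::'c::field. rel_trace r n x = 0} \<le> r ^ (n - 1)"
proof -
  define p :: "'c poly" where "p = (\<Sum>i<n. Polynomial.monom 1 (r ^ i))"
  have inj: "r ^ i = r ^ j \<longleftrightarrow> i = j" for i j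
    using assms by (simp add: power_inject_exp)
  have "poly.coeff p (r ^ (n - 1)) = (\<Sum>i<n. if i = n - 1 then 1 else 0)"
    by (auto simp: p_def coeff_sum inj intro!: sum.cong)
  also have "\<dots> = 1"
    using assms by simp
  finally have p0: "p \<noteq> 0"
    by auto
  have deg: "Polynomial.degree p \<le> r ^ (n - 1)"
    unfolding p_def
  proof (rule degree_sum_le)
    fix i assume "i \<in> {..<n}"
    then have "r ^ i \<le> r ^ (n - 1)"
      using assms by (intro power_increasing) auto
    then show "Polynomial.degree (Polynomial.monom (1::'c) (r ^ i)) \<le> r ^ (n - 1)"
      by (simp add: degree_monom_eq)
  qed simp
  have "poly p x = rel_trace r n x" for x
    by (simp add: p_def rel_trace_def poly_sum poly_monom)
  then show "finite {x::'c::field. rel_trace r n x = 0}"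
    "card {x::'c::field. rel_trace r n x = 0} \<le> r ^ (n - 1)"
    using poly_roots_finite[OF p0] card_poly_roots_bound[OF p0] deg by auto
qed

lemma rel_trace_add:
  assumes "CHAR('c::field) = 2" "r = 2 ^ e"
  shows "rel_trace r n (x + y :: 'c) = rel_trace r n x + rel_trace r n y"
  using assms(1) unfolding assms(2)
  by (simp add: rel_trace_def power_two_power_add sum.distrib flip: power_mult)

lemma rel_trace_square:
  assumes "CHAR('c::field) = 2"
  shows "rel_trace r n (x\<^sup>2 :: 'c) = (rel_trace r n x)\<^sup>2"
  using power_two_power_sum[OF assms, where e = 1 and A = "{..<n}" and f = "\<lambda>i. x ^ (r ^ i)"]
  by (simp add: rel_trace_def mult.commute flip: power_mult)

text \<open>Raising to the power \<open>r\<close> shifts the summation index by one; the term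
  gained, \<open>x ^ (r ^ n)\<close>, equals the term lost, \<open>x\<close>.\<close>

lemma rel_trace_in_fixed_field:
  assumes "CHAR('c::field) = 2" "r = 2 ^ e" "(x::'c) \<in> fixed_field (r ^ n)"
  shows "rel_trace r n x \<in> fixed_field r"
proof -
  have "rel_trace r n x ^ r = (\<Sum>i<n. x ^ (r ^ Suc i))"
    unfolding rel_trace_def assms(2) power_two_power_sum[OF assms(1)]
    by (simp add: mult.commute flip: power_mult)
  also have "\<dots> + x ^ (r ^ 0) = rel_trace r n x + x ^ (r ^ n)"
    using sum.lessThan_Suc[of "\<lambda>i. x ^ (r ^ i)" n] sum.lessThan_Suc_shift[of "\<lambda>i. x ^ (r ^ i)" n]
    unfolding rel_trace_def by (simp add: add.commute)
  finally show ?thesis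
    using assms(3) by (simp add: fixed_field_def)
qed

text \<open>All \<open>n\<close> conjugates coincide, and an odd \<open>n\<close> is
  \<open>1\<close> in characteristic 2. The disjointness of the spread members rests on
  this.\<close>

lemma rel_trace_of_fixed:
  assumes "CHAR('c::field) = 2" "odd n" "(c::'c) \<in> fixed_field r"
  shows "rel_trace r n c = c"
proof -
  have "rel_trace r n c = of_nat n * c"
    using power_power_fixed[OF assms(3)] by (simp add: rel_trace_def)
  moreover have "(of_nat n :: 'c) = 1"
    using assms(2) char2_simps(1)[OF assms(1)] by (auto elim!: oddE)
  ultimately show ?thesis
    by simp
qed

lemma fixed_field_card:
  assumes "CHAR('c::alg_closed_field) = 2" "r = 2 ^ e" "e > 0"
  shows "finite (fixed_field r :: 'c set)" "card (fixed_field r :: 'c set) = r"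
proof -
  have "r > 1" "2 dvd r"
    using assms one_less_power[of "2::nat" e] by auto
  then show "finite (fixed_field r :: 'c set)" "card (fixed_field r :: 'c set) = r"
    using card_power_fixed_points[where ?'c = 'c and N = r] assms(1)
    by (auto simp: fixed_field_def)
qed

text \<open>The multiples of a nonzero \<open>x\<close> fill the field, so all \<open>r ^ n\<close>
  of its elements would be zeros of a trace polynomial of degree at most
  \<open>r ^ (n - 1)\<close>.\<close>

lemma rel_trace_nondegenerate:
  assumes char: "CHAR('c::alg_closed_field) = 2" and r: "r = 2 ^ e" "e > 0" and n: "n > 0"
    and x: "(x::'c) \<in> fixed_field (r ^ n)"
    and 0: "\<And>y. y \<in> fixed_field (r ^ n) \<Longrightarrow> rel_trace r n (x * y) = 0"
  shows "x = 0"
proof (rule ccontr)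
  assume "x \<noteq> 0"
  have r1: "r > 1"
    using r one_less_power[of "2::nat" e] by simp
  have rn: "r ^ n = 2 ^ (e * n)" "e * n > 0"
    using r n by (auto simp: power_mult)
  have "fixed_field (r ^ n) \<subseteq> {z::'c. rel_trace r n z = 0}"
  proof
    fix z :: 'c assume "z \<in> fixed_field (r ^ n)"
    then show "z \<in> {z. rel_trace r n z = 0}"
      using 0[of "z / x"] x \<open>x \<noteq> 0\<close> by (simp add: fixed_field_divide)
  qed
  then have "card (fixed_field (r ^ n) :: 'c set) \<le> card {z::'c. rel_trace r n z = 0}"
    by (intro card_mono rel_trace_card_roots r1 n)
  also have "\<dots> \<le> r ^ (n - 1)"
    by (intro rel_trace_card_roots r1 n)
  also have "\<dots> < r ^ n"
    using r1 n by (intro power_strict_increasing) auto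
  finally show False
    using fixed_field_card(2)[OF char rn] by simp
qed

section \<open>The orthogonal spread\<close>

locale orthogonal_spread =
  fixes r e n :: nat and K L :: "'c::alg_closed_field set" and T :: "'c \<Rightarrow> 'c"
  assumes char: "CHAR('c) = 2" and r: "r = 2 ^ e" and e: "e > 0" and n: "odd n"
  defines "K \<equiv> fixed_field r" and "L \<equiv> fixed_field (r ^ n)" and "T \<equiv> rel_trace r n"
begin

definition form :: "'c \<times> 'c \<times> 'c \<times> 'c \<Rightarrow> 'c" where
  "form = (\<lambda>(x, a, y, b). T (x * y) + a * b)"

definition space :: "('c \<times> 'c \<times> 'c \<times> 'c) set" where
  "space = L \<times> K \<times> L \<times> K"

text \<open>For \<open>s\<close> in \<open>L\<close> this is the graph of a \<open>K\<close>-linear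
  map on \<open>L \<times> K\<close>, alternating with respect to the pairing
  \<open>T (x * y) + a * b\<close>. These maps form a Kerdock set: the difference of any two is
  nonsingular, as \<open>member_disjoint\<close> shows.\<close>

definition member :: "'c \<Rightarrow> ('c \<times> 'c \<times> 'c \<times> 'c) set" where
  "member s = (\<lambda>(x, a). (x, a, s\<^sup>2 * x + s * T (s * x) + s * a, T (s * x))) ` (L \<times> K)"

definition member_inf :: "('c \<times> 'c \<times> 'c \<times> 'c) set" where
  "member_inf = {0} \<times> {0} \<times> L \<times> K"

definition members :: "('c \<times> 'c \<times> 'c \<times> 'c) set set" where
  "members = insert member_inf (member ` L)"

definition scale :: "'c \<Rightarrow> 'c \<times> 'c \<times> 'c \<times> 'c \<Rightarrow> 'c \<times> 'c \<times> 'c \<times> 'c" where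
  "scale c = (\<lambda>(x, a, y, b). (c * x, c * a, c * y, c * b))"

section \<open>Arithmetic of the fields \<open>K\<close> and \<open>L\<close>\<close>

lemma n_pos: "n > 0"
  using n by (cases n) auto

lemma r_gt_1: "r > 1"
  using r e one_less_power[of "2::nat" e] by simp

lemma r_power: "r ^ n = 2 ^ (e * n)" "e * n > 0"
  using r e n_pos by (auto simp: power_mult)

lemma K_subset_L: "K \<subseteq> L"
  unfolding K_def L_def by (rule fixed_field_mono)

lemma card_K: "finite K" "card K = r" and card_L: "finite L" "card L = r ^ n"
  unfolding K_def L_def using fixed_field_card[OF char r e] fixed_field_card[OF char r_power] by auto

lemma K_closed: "0 \<in> K" "x \<in> K \<Longrightarrow> y \<in> K \<Longrightarrow> x + y \<in> K" "x \<in> K \<Longrightarrow> y \<in> K \<Longrightarrow> x * y \<in> K"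
  "x \<in> K \<Longrightarrow> y \<in> K \<Longrightarrow> x / y \<in> K"
  unfolding K_def using fixed_field_add[OF char, of x e y] r_gt_1
  by (auto simp: r fixed_field_mult fixed_field_divide)

lemma L_closed: "0 \<in> L" "x \<in> L \<Longrightarrow> y \<in> L \<Longrightarrow> x + y \<in> L" "x \<in> L \<Longrightarrow> y \<in> L \<Longrightarrow> x * y \<in> L"
  "x \<in> L \<Longrightarrow> x\<^sup>2 \<in> L" "x \<in> K \<Longrightarrow> x \<in> L"
  unfolding L_def r_power using fixed_field_add[OF char, of x "e * n" y] K_subset_L[unfolded L_def r_power]
  by (auto simp: fixed_field_mult power2_eq_square)

lemma T_simps: "T 0 = 0" "T (x + y) = T x + T y" "c \<in> K \<Longrightarrow> T (c * x) = c * T x"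
  "x \<in> L \<Longrightarrow> T x \<in> K" "T (x\<^sup>2) = (T x)\<^sup>2" "c \<in> K \<Longrightarrow> T c = c"
  unfolding T_def K_def L_def
  using rel_trace_add[OF char r] rel_trace_smult rel_trace_in_fixed_field[OF char r]
    rel_trace_square[OF char] rel_trace_of_fixed[OF char n] r_gt_1
  by auto

lemma form_in_K: "v \<in> space \<Longrightarrow> form v \<in> K"
  by (auto simp: space_def form_def intro!: K_closed T_simps(4) L_closed(3))

lemma form_scale: "c \<in> K \<Longrightarrow> form (scale c v) = c\<^sup>2 * form v"
  by (auto simp: form_def scale_def split_def algebra_simps power2_eq_square T_simps)

section \<open>The members as totally singular subspaces\<close>

lemma members_subset: "S \<in> members \<Longrightarrow> S \<subseteq> space"
  by (auto simp: members_def member_def member_inf_def space_def L_closed K_closed T_simps)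

lemma card_members:
  assumes "S \<in> members" shows "card S = r ^ Suc n"
proof -
  have "card (L \<times> K) = r ^ Suc n"
    by (simp add: card_cartesian_product card_K card_L)
  moreover have "inj_on (\<lambda>(x, a). (x, a, s\<^sup>2 * x + s * T (s * x) + s * a, T (s * x))) (L \<times> K)" for s
    by (auto simp: inj_on_def)
  ultimately show ?thesis
    using assms by (auto simp: members_def member_def member_inf_def card_image card_cartesian_product)
qed

lemma zero_in_members: "S \<in> members \<Longrightarrow> 0 \<in> S"
  by (auto simp: members_def member_def member_inf_def zero_prod_def image_iff L_closed K_closed
      T_simps intro!: bexI[of _ "(0, 0)"])

lemma members_add:
  assumes "S \<in> members" "v \<in> S" "w \<in> S" shows "v + w \<in> S"
proof -
  have "v + w \<in> member s" if vw: "v \<in> member s" "w \<in> member s" for s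
  proof -
    obtain x a x' a' where *: "x \<in> L" "x' \<in> L" "a \<in> K" "a' \<in> K"
      "v = (x, a, s\<^sup>2 * x + s * T (s * x) + s * a, T (s * x))"
      "w = (x', a', s\<^sup>2 * x' + s * T (s * x') + s * a', T (s * x'))"
      using vw by (auto simp: member_def)
    have "(x + x', a + a') \<in> L \<times> K"
      using * L_closed K_closed by auto
    then show ?thesis
      using * unfolding member_def
      by (intro image_eqI[of _ _ "(x + x', a + a')"]) (auto simp: algebra_simps T_simps)
  qed
  moreover have "v + w \<in> member_inf" if "v \<in> member_inf" "w \<in> member_inf"
    using that by (auto simp: member_inf_def image_iff L_closed K_closed)
  ultimately show ?thesis
    using assms by (auto simp: members_def)
qed

lemma members_scale:
  assumes "S \<in> members" "v \<in> S" "c \<in> K" shows "scale c v \<in> S"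
proof -
  have "scale c v \<in> member s" if v: "v \<in> member s" for s
  proof -
    obtain x a where *: "x \<in> L" "a \<in> K"
      "v = (x, a, s\<^sup>2 * x + s * T (s * x) + s * a, T (s * x))"
      using v by (auto simp: member_def)
    have "(c * x, c * a) \<in> L \<times> K"
      using * L_closed K_closed assms(3) by auto
    moreover have "T (s * (c * x)) = c * T (s * x)"
      using T_simps(3)[OF assms(3)] by (simp add: mult.left_commute)
    ultimately show ?thesis
      using * unfolding member_def scale_def
      by (intro image_eqI[of _ _ "(c * x, c * a)"]) (auto simp: algebra_simps)
  qed
  moreover have "scale c v \<in> member_inf" if "v \<in> member_inf"
    using that assms(3) by (auto simp: member_inf_def scale_def image_iff L_closed K_closed)
  ultimately show ?thesis
    using assms by (auto simp: members_def)
qed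

text \<open>With \<open>u = s * x\<close>, the identity \<open>T (u\<^sup>2) = (T u)\<^sup>2\<close>
  turns the value into two copies of \<open>(T u)\<^sup>2\<close> and two of \<open>a * T u\<close>,
  which cancel in characteristic 2.\<close>

lemma form_members:
  assumes "S \<in> members" "v \<in> S" shows "form v = 0"
proof -
  have "form v = 0" if v: "v \<in> member s" "s \<in> L" for s
  proof -
    obtain x a where *: "x \<in> L" "a \<in> K"
      "v = (x, a, s\<^sup>2 * x + s * T (s * x) + s * a, T (s * x))"
      using v by (auto simp: member_def)
    have "T (s * x) \<in> K"
      using * v by (intro T_simps(4) L_closed(3))
    have "form v = T ((s * x)\<^sup>2 + T (s * x) * (s * x) + a * (s * x)) + a * T (s * x)"
      using *(3) by (simp add: form_def algebra_simps power2_eq_square)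
    also have "\<dots> = (T (s * x))\<^sup>2 + T (s * x) * T (s * x) + a * T (s * x) + a * T (s * x)"
      using * \<open>T (s * x) \<in> K\<close> by (simp only: T_simps)
    also have "\<dots> = 0"
      by (simp add: power2_eq_square char2_simps[OF char] add.assoc)
    finally show ?thesis .
  qed
  moreover have "form v = 0" if "v \<in> member_inf"
    using that by (auto simp: member_inf_def form_def T_simps)
  ultimately show ?thesis
    using assms by (auto simp: members_def)
qed

section \<open>Pairwise disjointness and covering of the singular vectors\<close>

lemma member_inf_disjoint: "member_inf \<inter> member s = {0}"
  using zero_in_members[of "member_inf"]
  by (auto simp: member_inf_def member_def zero_prod_def T_simps members_def image_iff L_closed K_closed
      intro!: bexI[of _ "(0,0)"])

text \<open>Subtracting the two equations for the third coordinate gives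
  \<open>(s + t) x = T (s x) + a \<in> K\<close>; since \<open>n\<close> is odd, the trace fixes this element,
  while \<open>T (s x) = T (t x)\<close> forces its trace to vanish.\<close>

lemma member_disjoint:
  assumes "s \<in> L" "t \<in> L" "s \<noteq> t"
  shows "member s \<inter> member t = {0}"
proof -
  note c2 = char2_simps[OF char]
  have "v = 0" if v: "v \<in> member s" "v \<in> member t" for v
  proof -
    obtain x a where *: "x \<in> L" "a \<in> K"
      "v = (x, a, s\<^sup>2 * x + s * T (s * x) + s * a, T (s * x))"
      using v by (auto simp: member_def)
    have eqs: "T (t * x) = T (s * x)"
      "s\<^sup>2 * x + s * T (s * x) + s * a = t\<^sup>2 * x + t * T (t * x) + t * a"
      using * v(2) by (auto simp: member_def)
    define c where "c = T (s * x)"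
    have c: "c \<in> K"
      unfolding c_def using * assms by (intro T_simps(4) L_closed(3))
    have "(s + t) * ((s + t) * x + c + a)
        = (s\<^sup>2 * x + s * c + s * a) + (t\<^sup>2 * x + t * c + t * a) + (s * t * x + s * t * x)"
      by (simp add: algebra_simps power2_eq_square)
    also have "\<dots> = 0"
      using eqs unfolding c_def by (simp add: c2)
    finally have "(s + t) * x + (c + a) = 0"
      using assms(3) c2(5)[of s t] by (simp add: add.assoc)
    then have eq: "(s + t) * x = c + a"
      using c2(5) by blast
    have "T ((s + t) * x) = T (s * x) + T (t * x)"
      by (simp only: distrib_right T_simps)
    then have "T (c + a) = 0"
      using eqs(1) eq by (simp add: c2)
    moreover have "T (c + a) = c + a"
      using c * by (intro T_simps K_closed)
    ultimately have ca: "c + a = 0"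
      by simp
    then have "x = 0"
      using eq assms(3) c2(5)[of s t] by auto
    then have "c = 0"
      by (simp add: c_def T_simps)
    then show "v = 0"
      using \<open>x = 0\<close> ca *(3) by (simp add: zero_prod_def T_simps)
  qed
  moreover have "0 \<in> member s" "0 \<in> member t"
    using zero_in_members assms by (auto simp: members_def)
  ultimately show ?thesis
    by auto
qed

lemma members_disjoint:
  assumes "S \<in> members" "S' \<in> members" "S \<noteq> S'" shows "S \<inter> S' = {0}"
  using assms unfolding members_def
  by (elim insertE imageE) (simp_all add: member_inf_disjoint Int_commute, metis member_disjoint Int_commute)

text \<open>If two differently labelled members coincided, they would equal their intersection
  \<open>{0}\<close>, but a member has \<open>r ^ Suc n > 1\<close> elements.\<close>

lemma member_neq:
  shows "inj_on member L" "member_inf \<notin> member ` L"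
proof -
  have "S \<noteq> {0}" if "S \<in> members" for S
    using card_members[OF that] r_gt_1 power_gt1[of r n] by auto
  then have *: "member s \<noteq> {0}" if "s \<in> L" for s
    using that by (auto simp: members_def)
  show "inj_on member L"
    using * member_disjoint by (intro inj_onI) (metis inf.idem)
  show "member_inf \<notin> member ` L"
    using * member_inf_disjoint by (metis imageE inf.idem)
qed

lemma card_set_members: "finite members" "card members = r ^ n + 1"
  using member_neq card_L by (simp_all add: members_def card_image)

text \<open>For \<open>(x, a) \<noteq> 0\<close> the vectors \<open>(x, a, y, b)\<close> of the members indexed by \<open>L\<close> are
  distinct, and there are at most \<open>card L\<close> singular vectors of this shape, so they exhaust them.\<close>

lemma singular_in_member:
  assumes "v \<in> space" "form v = 0"
  shows "\<exists>S\<in>members. v \<in> S"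
proof -
  obtain x a y b where v: "v = (x, a, y, b)" "x \<in> L" "a \<in> K" "y \<in> L" "b \<in> K"
    using assms by (auto simp: space_def)
  show ?thesis
  proof (cases "x = 0 \<and> a = 0")
    case True
    then have "v \<in> member_inf"
      using v by (auto simp: member_inf_def)
    then show ?thesis
      by (auto simp: members_def)
  next
    case False
    define Z where "Z = {(y, b). y \<in> L \<and> b \<in> K \<and> T (x * y) + a * b = 0}"
    define g where "g s = (s\<^sup>2 * x + s * T (s * x) + s * a, T (s * x))" for s
    have gmem: "(x, a, g s) \<in> member s" for s
      using v by (auto simp: member_def g_def)
    have Zsub: "Z \<subseteq> L \<times> K"
      by (auto simp: Z_def)
    then have finZ: "finite Z"
      using card_L card_K finite_subset by blast
    have "g ` L \<subseteq> Z"
    proof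
      fix z assume "z \<in> g ` L"
      then obtain s where s: "s \<in> L" "z = g s" by auto
      then have "(x, a, g s) \<in> space" "form (x, a, g s) = 0"
        using gmem members_subset[of "member s"] form_members[of "member s"]
        by (auto simp: members_def)
      then show "z \<in> Z"
        using s by (auto simp: Z_def form_def space_def g_def)
    qed
    moreover have "inj_on g L"
    proof (rule inj_onI, rule ccontr)
      fix s t assume st: "s \<in> L" "t \<in> L" "g s = g t" "s \<noteq> t"
      then have "(x, a, g s) \<in> member s \<inter> member t"
        using gmem[of s] gmem[of t] by auto
      then show False
        using False st member_disjoint[of s t] by (auto simp: zero_prod_def)
    qed
    then have "card (g ` L) = r ^ n"
      by (simp add: card_image card_L)
    \<comment> \<open>If \<open>a = 0\<close>, then \<open>b\<close> is free and
      \<open>x * y\<close> ranges over trace-zero elements; otherwise \<open>y\<close> determines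
      \<open>b\<close>. Either way at most \<open>r ^ n\<close> pairs remain.\<close>
    moreover have "card Z \<le> r ^ n"
    proof (cases "a = 0")
      case True
      with False have "x \<noteq> 0" by auto
      have "(\<lambda>(y, b). (x * y, b)) ` Z \<subseteq> {z. T z = 0} \<times> K"
        using True by (auto simp: Z_def)
      moreover have fin: "finite {z. T z = 0}" "card {z. T z = 0} \<le> r ^ (n - 1)"
        unfolding T_def by (intro rel_trace_card_roots r_gt_1 n_pos)+
      moreover have "inj_on (\<lambda>(y, b). (x * y, b)) Z"
        using \<open>x \<noteq> 0\<close> by (auto simp: inj_on_def)
      ultimately have "card Z \<le> card ({z. T z = 0} \<times> K)"
        using card_K by (intro card_inj_on_le[of "\<lambda>(y, b). (x * y, b)"]) auto
      also have "\<dots> \<le> r ^ (n - 1) * r"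
        using fin by (simp add: card_cartesian_product card_K)
      also have "\<dots> = r ^ n"
        using n_pos by (intro power_minus_mult)
      finally show ?thesis .
    next
      case False
      have "Z \<subseteq> (\<lambda>y. (y, T (x * y) / a)) ` L"
      proof
        fix z assume "z \<in> Z"
        then obtain y b where z: "z = (y, b)" "y \<in> L" "T (x * y) + a * b = 0"
          by (auto simp: Z_def)
        then have "T (x * y) = a * b"
          using char2_simps(5)[OF char] by blast
        then show "z \<in> (\<lambda>y. (y, T (x * y) / a)) ` L"
          using z False by auto
      qed
      then have "card Z \<le> card L"
        using card_L by (rule_tac surj_card_le)
      then show ?thesis
        by (simp add: card_L)
    qed
    ultimately have "g ` L = Z"
      using finZ by (intro card_seteq) auto
    moreover have "(y, b) \<in> Z"
      using assms v by (auto simp: Z_def form_def)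
    ultimately obtain s where "s \<in> L" "g s = (y, b)"
      by auto
    then show ?thesis
      using gmem[of s] v by (auto simp: members_def)
  qed
qed

section \<open>The polar form and its nondegeneracy after descent\<close>

definition polar :: "'c \<times> 'c \<times> 'c \<times> 'c \<Rightarrow> 'c \<times> 'c \<times> 'c \<times> 'c \<Rightarrow> 'c" where
  "polar = (\<lambda>(x, a, y, b) (x', a', y', b'). T (x * y' + x' * y) + a * b' + a' * b)"

lemma form_add_polar: "form (v + w) = form v + form w + polar v w"
  by (cases v; cases w) (simp add: form_def polar_def algebra_simps T_simps(2))

lemma polar_add: "polar v (w + w') = polar v w + polar v w'"
  by (cases v; cases w; cases w') (simp add: polar_def T_simps algebra_simps)

lemma polar_scale:
  assumes "c \<in> K" shows "polar v (scale c w) = c * polar v w"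
proof -
  have "T (x * (c * y)) = c * T (x * y)" "T (c * x * y) = c * T (x * y)" for x y
    using T_simps(3)[OF assms, of "x * y"] by (simp_all add: mult_ac)
  then show ?thesis
    by (cases v; cases w) (simp add: polar_def scale_def T_simps(2) distrib_left mult.left_commute mult.assoc)
qed

lemma space_add: "v \<in> space \<Longrightarrow> w \<in> space \<Longrightarrow> v + w \<in> space"
  and space_scale: "c \<in> K \<Longrightarrow> v \<in> space \<Longrightarrow> scale c v \<in> space"
  by (auto simp: space_def scale_def K_closed L_closed)

text \<open>Pairing \<open>v\<close> with vectors supported in one coordinate isolates each
  coordinate of \<open>v\<close>; nondegeneracy of the traces, one for \<open>K\<close> and two in
  succession for \<open>L\<close>, then makes it vanish.\<close>

lemma polar_nondegenerate:
  assumes q: "r = q ^ k" "q = 2 ^ d" "d > 0" "k > 0"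
    and v: "v \<in> space" "\<And>w. w \<in> space \<Longrightarrow> rel_trace q k (polar v w) = 0"
  shows "v = 0"
proof -
  obtain x a y b where v': "v = (x, a, y, b)" "x \<in> L" "a \<in> K" "y \<in> L" "b \<in> K"
    using v(1) by (auto simp: space_def)
  have tr: "z = 0" if "z \<in> K" "\<And>c. c \<in> K \<Longrightarrow> rel_trace q k (z * c) = 0" for z
    using rel_trace_nondegenerate[OF char q(2,3,4), of z] that by (simp add: K_def q(1))
  have TT: "z = 0" if "z \<in> L" "\<And>c. c \<in> L \<Longrightarrow> rel_trace q k (T (z * c)) = 0" for z
  proof -
    have "T (z * c) = 0" if c: "c \<in> L" for c
    proof (rule tr)
      show "T (z * c) \<in> K"
        using \<open>z \<in> L\<close> c by (intro T_simps(4) L_closed(3))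
      \<comment> \<open>The scalar \<open>l\<close> is moved inside \<open>T\<close>, so the
        hypothesis at \<open>l * c\<close> applies.\<close>
      show "rel_trace q k (T (z * c) * l) = 0" if "l \<in> K" for l
        using \<open>\<And>c. c \<in> L \<Longrightarrow> rel_trace q k (T (z * c)) = 0\<close>[of "l * c"] T_simps(3)[OF that, of "z * c"] c that
        by (simp add: L_closed mult_ac)
    qed
    then show ?thesis
      using rel_trace_nondegenerate[OF char r e n_pos, of z] that(1) unfolding T_def L_def by simp
  qed
  have 0: "rel_trace q k (polar v w) = 0" if "w \<in> L \<times> K \<times> L \<times> K" for w
    using v(2) that by (simp add: space_def)
  have "x = 0"
  proof (rule TT)
    show "rel_trace q k (T (x * c)) = 0" if "c \<in> L" for c
      using 0[of "(0, 0, c, 0)"] that by (simp add: v' polar_def K_closed L_closed)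
  qed fact
  moreover have "y = 0"
  proof (rule TT)
    show "rel_trace q k (T (y * c)) = 0" if "c \<in> L" for c
      using 0[of "(c, 0, 0, 0)"] that by (simp add: v' polar_def K_closed L_closed mult.commute)
  qed fact
  moreover have "a = 0"
  proof (rule tr)
    show "rel_trace q k (a * c) = 0" if "c \<in> K" for c
      using 0[of "(0, 0, 0, c)"] that by (simp add: v' polar_def K_closed L_closed T_simps(1))
  qed fact
  moreover have "b = 0"
  proof (rule tr)
    show "rel_trace q k (b * c) = 0" if "c \<in> K" for c
      using 0[of "(0, c, 0, 0)"] that by (simp add: v' polar_def K_closed L_closed T_simps(1) mult.commute)
  qed fact
  ultimately show ?thesis
    using v' by (simp add: zero_prod_def)
qed

text \<open>On a subgroup without nonzero singular vectors \<open>form ^ (r - 1)\<close> is the indicator function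
  of the nonzero vectors, so it sums to \<open>1\<close>. But \<open>r - 1 = \<Sum>j<e. 2 ^ j\<close>, and each
  \<open>form ^ 2 ^ j\<close> is a sum of products of two additive maps.\<close>

lemma exists_singular_vector:
  assumes W: "W \<subseteq> space" "add_closed W" "2 ^ (2 * e) < card W"
  shows "\<exists>w\<in>W. w \<noteq> 0 \<and> form w = 0"
proof (rule ccontr)
  assume none: "\<not> ?thesis"
  note c2 = char2_simps[OF char]
  have fin: "finite W"
    using W(3) card_ge_0_finite by force
  have "0 \<in> W"
    using W by (simp add: add_closed_def)
  have vv: "v + v = 0" for v :: "'c \<times> 'c \<times> 'c \<times> 'c"
    by (cases v) (simp add: c2 zero_prod_def)
  \<comment> \<open>The order of \<open>W\<close> is even, so \<open>card W - 1\<close> becomes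
    \<open>-1\<close> in the field.\<close>
  obtain d where d: "card W = 2 ^ d"
    using card_add_closed_power_two[OF vv fin W(2)] by blast
  have "d \<noteq> 0"
    using d W(3) by (intro notI) auto
  have "form w ^ (r - 1) = (if w = 0 then 0 else 1)" if "w \<in> W" for w
  proof (cases "w = 0")
    case True
    then show ?thesis
      using r_gt_1 by (simp add: form_def zero_prod_def T_simps)
  next
    case False
    then have "form w \<noteq> 0" "form w ^ r = form w"
      using none that form_in_K[of w] W(1) by (auto simp: K_def fixed_field_def)
    moreover have "form w ^ (r - 1) * form w = form w ^ r"
      using r_gt_1 by (intro power_minus_mult) simp
    ultimately show ?thesis
      using False \<open>form w \<noteq> 0\<close> by simp
  qed
  then have "(\<Sum>w\<in>W. form w ^ (r - 1)) = (\<Sum>w\<in>W. if w = 0 then 0 else 1)"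
    by (intro sum.cong) auto
  also have "\<dots> = (\<Sum>w\<in>W - {0}. 1)"
    using fin by (intro sum.mono_neutral_cong_right) auto
  also have "\<dots> = of_nat (card W - 1)"
    using fin \<open>0 \<in> W\<close> by simp
  also have "\<dots> = of_nat (card W) - 1"
    using W(3) by (subst of_nat_diff) auto
  also have "\<dots> = - 1"
    using d \<open>d \<noteq> 0\<close> by (simp add: c2(1) zero_power)
  finally have sum1: "(\<Sum>w\<in>W. form w ^ (r - 1)) = - 1" .

  \<comment> \<open>Indices below \<open>n\<close> give the conjugates of \<open>x\<close> and
    \<open>y\<close> whose products add up to \<open>T (x * y)\<close>; the index \<open>n\<close>
    gives the remaining product \<open>a * b\<close>.\<close>
  define G :: "nat \<Rightarrow> 'c \<times> 'c \<times> 'c \<times> 'c \<Rightarrow> 'c" where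
    "G i = (\<lambda>(x, a, y, b). if i < n then x ^ (r ^ i) else a)" for i
  define H :: "nat \<Rightarrow> 'c \<times> 'c \<times> 'c \<times> 'c \<Rightarrow> 'c" where
    "H i = (\<lambda>(x, a, y, b). if i < n then y ^ (r ^ i) else b)" for i
  have pow_add: "(x + y :: 'c) ^ (r ^ i) = x ^ (r ^ i) + y ^ (r ^ i)" for x y i
    unfolding r power_mult[symmetric] by (rule power_two_power_add[OF char])
  have GH_add: "G i (v + w) = G i v + G i w" "H i (v + w) = H i v + H i w" for i v w
    by (cases v; cases w; simp add: G_def H_def pow_add)+
  have form_eq: "form w = (\<Sum>i<Suc n. G i w * H i w)" for w
    by (cases w) (simp add: form_def T_def rel_trace_def G_def H_def power_mult_distrib)
  \<comment> \<open>The function \<open>f\<close> picks one summand of \<open>form\<close> for each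
    \<open>j\<close>, and the Boolean picks one of its two additive factors. Frobenius powers of
    additive maps stay additive.\<close>
  define g where "g f = (\<lambda>(j, \<beta>) w. (if \<beta> then G (f j) w else H (f j) w) ^ (2 ^ j))"
    for f :: "nat \<Rightarrow> nat"
  have r1: "r - 1 = (\<Sum>j<e. 2 ^ j)"
    by (simp add: r mask_eq_sum_exp_nat lessThan_def)
  have "form w ^ (r - 1) = (\<Sum>f\<in>{..<e} \<rightarrow>\<^sub>E {..<Suc n}. \<Prod>p\<in>{..<e} \<times> UNIV. g f p w)" for w
  proof -
    have "form w ^ (r - 1) = (\<Prod>j<e. \<Sum>i<Suc n. (G i w * H i w) ^ (2 ^ j))"
      unfolding r1 power_sum form_eq by (simp only: power_two_power_sum[OF char])
    also have "\<dots> = (\<Sum>f\<in>{..<e} \<rightarrow>\<^sub>E {..<Suc n}. \<Prod>j<e. (G (f j) w * H (f j) w) ^ (2 ^ j))"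
      by (rule prod_sum_PiE) auto
    also have "\<dots> = (\<Sum>f\<in>{..<e} \<rightarrow>\<^sub>E {..<Suc n}. \<Prod>p\<in>{..<e} \<times> UNIV. g f p w)"
      by (simp add: prod.cartesian_product' g_def UNIV_bool power_mult_distrib mult.commute)
    finally show ?thesis .
  qed
  then have "(\<Sum>w\<in>W. form w ^ (r - 1))
      = (\<Sum>f\<in>{..<e} \<rightarrow>\<^sub>E {..<Suc n}. \<Sum>w\<in>W. \<Prod>p\<in>{..<e} \<times> (UNIV :: bool set). g f p w)"
    by (simp only:) (rule sum.swap)
  also have "\<dots> = 0"
  \<comment> \<open>Each expanded product has \<open>2 * e\<close> additive factors, which is why
    the size hypothesis on \<open>W\<close> has that exponent.\<close>
  proof (rule sum.neutral, rule ballI, rule sum_prod_additive_eq_0)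
    show "2 ^ card ({..<e} \<times> (UNIV :: bool set)) < card W"
      using W(3) by (simp add: card_cartesian_product mult.commute)
    show "g f p (v + w) = g f p v + g f p w" for f p v w
      by (cases p) (simp add: g_def GH_add power_two_power_add[OF char])
  qed (use vv c2 fin W in auto)
  finally show False
    using sum1 by simp
qed

end

section \<open>Vector spaces over finite fields\<close>

text \<open>A new independent vector \<open>b\<close> multiplies the size by
  \<open>CARD('a)\<close>, since each vector of the larger span is \<open>scale c b + v\<close> for
  a unique \<open>c\<close> and a unique \<open>v\<close> in the old span.\<close>

lemma (in vector_space) card_span_finite_field:
  assumes "finite (UNIV :: 'a set)" "finite B" "independent B"
  shows "finite (span B)" "card (span B) = CARD('a) ^ card B"
proof -
  have "finite (span B) \<and> card (span B) = CARD('a) ^ card B"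
    using assms(2,3)
  proof (induction B rule: finite_induct)
    case empty
    then show ?case by simp
  next
    case (insert b B)
    let ?g = "\<lambda>(c, v). scale c b + v"
    from insert have B: "independent B" "b \<notin> span B"
      by (auto simp: independent_insert)
    have "span (insert b B) = ?g ` (UNIV \<times> span B)"
    proof (intro Set.set_eqI iffI)
      fix x assume "x \<in> span (insert b B)"
      then obtain c where "x - scale c b \<in> span B"
        by (auto simp: span_breakdown_eq)
      then show "x \<in> ?g ` (UNIV \<times> span B)"
        by (intro image_eqI[of _ _ "(c, x - scale c b)"]) auto
    next
      fix x assume "x \<in> ?g ` (UNIV \<times> span B)"
      then obtain c v where "v \<in> span B" "x = scale c b + v"
        by auto
      then have "x - scale c b \<in> span B"
        by simp
      then show "x \<in> span (insert b B)"
        by (auto simp: span_breakdown_eq)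
    qed
    moreover have "inj_on ?g (UNIV \<times> span B)"
    proof (rule inj_onI, clarify)
      fix c v d w assume *: "v \<in> span B" "w \<in> span B" "scale c b + v = scale d b + w"
      then have eq: "scale (c - d) b = w - v"
        by (simp add: scale_left_diff_distrib algebra_simps)
      have "c = d"
      proof (rule ccontr)
        assume "c \<noteq> d"
        then have "b = scale (inverse (c - d)) (w - v)"
          using eq[symmetric] by simp
        then show False
          using B * span_scale span_diff by metis
      qed
      then show "c = d \<and> v = w"
        using * by simp
    qed
    moreover have "finite (span B) \<and> card (span B) = CARD('a) ^ card B"
      using insert B by simp
    ultimately show ?case
      using insert assms(1) by (simp add: card_image card_cartesian_product)
  qed
  then show "finite (span B)" "card (span B) = CARD('a) ^ card B"
    by auto
qed

lemma card_subspace_vec: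
  fixes U :: "('a::{field,finite} ^ 'n::finite) set"
  assumes "vec.subspace U"
  shows "card U = CARD('a) ^ vec.dim U"
proof -
  obtain B where B: "B \<subseteq> U" "vec.independent B" "U \<subseteq> vec.span B" "card B = vec.dim U"
    using vec.basis_exists by blast
  then have "vec.span B = U"
    using assms by (metis vec.span_minimal subset_antisym)
  moreover have "finite B"
    using B(2) vec.finiteI_independent by blast
  ultimately show ?thesis
    using vec.card_span_finite_field[of B] B by simp
qed

lemma card_vec: "CARD('a::{field,finite} ^ 'n::finite) = CARD('a) ^ CARD('n)"
  using card_subspace_vec[of "UNIV :: ('a ^ 'n) set"] by (simp add: vec_dim_card)

text \<open>The cardinality alone forces a basis of \<open>CARD('n)\<close> vectors. This transfers
  the concrete model inside the closure to \<open>'a ^ 'n\<close>.\<close>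

lemma finite_subspace_coordinates:
  fixes s :: "'a::{field,finite} \<Rightarrow> 'b::ab_group_add \<Rightarrow> 'b"
  assumes "vector_space s" "module.subspace s V" "finite V" "card V = CARD('a) ^ CARD('n::finite)"
  obtains \<phi> :: "'a ^ 'n \<Rightarrow> 'b"
  where "\<And>u v. \<phi> (u + v) = \<phi> u + \<phi> v" "\<And>c v. \<phi> (c *s v) = s c (\<phi> v)" "bij_betw \<phi> UNIV V"
proof -
  interpret vector_space s by fact
  obtain B where B: "B \<subseteq> V" "independent B" "V \<subseteq> span B"
    by (rule maximal_independent_subset)
  have finB: "finite B"
    using B assms finite_subset by blast
  have spanB: "span B = V"
    using B assms by (metis span_minimal subset_antisym)
  have "CARD('a) > 1"
    using card_mono[of UNIV "{0, 1::'a}"] by auto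
  then have "card B = CARD('n)"
    using card_span_finite_field[of B] finB B spanB assms(4) by (simp add: power_inject_exp)
  then obtain \<beta> :: "'n \<Rightarrow> 'b" where \<beta>: "bij_betw \<beta> UNIV B"
    using finB by (metis finite_same_card_bij finite)
  define \<phi> where "\<phi> v = (\<Sum>i\<in>UNIV. s (v $ i) (\<beta> i))" for v :: "'a ^ 'n"
  have "range \<phi> = V"
  proof
    show "range \<phi> \<subseteq> V"
    proof
      fix x assume "x \<in> range \<phi>"
      moreover have "\<beta> i \<in> B" for i
        using \<beta> by (auto simp: bij_betw_def)
      ultimately show "x \<in> V"
        unfolding \<phi>_def spanB[symmetric] by (auto intro!: span_sum span_scale intro: span_base)
    qed
    show "V \<subseteq> range \<phi>"
    proof
      fix x assume "x \<in> V"
      then obtain u where u: "x = (\<Sum>b\<in>B. s (u b) b)"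
        using span_finite[OF finB] spanB by auto
      have "\<phi> (\<chi> i. u (\<beta> i)) = x"
        unfolding u \<phi>_def using sum.reindex_bij_betw[OF \<beta>, of "\<lambda>b. s (u b) b"] by simp
      then show "x \<in> range \<phi>"
        by blast
    qed
  qed
  \<comment> \<open>A surjection between finite sets of equal size is injective.\<close>
  moreover from this have "inj \<phi>"
    using assms(4) by (intro eq_card_imp_inj_on) (simp_all add: card_vec)
  ultimately have "bij_betw \<phi> UNIV V"
    by (simp add: bij_betw_def)
  then show ?thesis
    by (intro that[of \<phi>])
      (simp_all add: \<phi>_def scale_left_distrib sum.distrib scale_sum_right)
qed

text \<open>After rescaling \<open>w\<close> to value \<open>1\<close>, the space \<open>W\<close>
  is the direct sum of the line through \<open>w\<close> and the kernel of \<open>f\<close> on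
  \<open>W\<close>.\<close>

lemma card_subspace_functional:
  fixes W :: "('a::{field,finite} ^ 'n::finite) set"
  assumes W: "vec.subspace W" and lin: "Vector_Spaces.linear (*s) (*) f"
    and w: "w \<in> W" "f w \<noteq> 0"
  shows "card W = CARD('a) * card {v\<in>W. f v = 0}"
proof -
  have f: "f (x + y) = f x + f y" "f (c *s x) = c * f x" for x y c
    using lin by (auto simp: Vector_Spaces.linear_iff)
  have f_diff: "f (x - y) = f x - f y" for x y
    using f(1)[of "x - y" y] by (simp add: algebra_simps)
  define w1 where "w1 = inverse (f w) *s w"
  have w1: "w1 \<in> W" "f w1 = 1"
    using w W by (auto simp: w1_def f vec.subspace_scale)
  have "bij_betw (\<lambda>(c, v). c *s w1 + v) (UNIV \<times> {v\<in>W. f v = 0}) W"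
  proof (rule bij_betw_byWitness[where f' = "\<lambda>v. (f v, v - f v *s w1)"])
    show "(\<lambda>v. (f v, v - f v *s w1)) ` W \<subseteq> UNIV \<times> {v \<in> W. f v = 0}"
      using w1 W by (auto simp: f f_diff intro!: vec.subspace_diff vec.subspace_scale)
  qed (use w1 W in \<open>auto simp: f intro!: vec.subspace_add vec.subspace_scale\<close>)
  then show ?thesis
    using bij_betw_same_card by (fastforce simp: card_cartesian_product)
qed

text \<open>The pairs \<open>(u, v) \<in> U \<times> V\<close> with \<open>f u v = 0\<close>, counted in two ways, give
  \<open>card U * card U\<^sup>\<perp> = card V\<close>.\<close>

lemma card_isotropic_le:
  fixes U :: "('a::{field,finite} ^ 'n::finite) set"
  assumes f: "bilinear_form f" and nondeg: "\<And>u. (\<And>v. f u v = 0) \<Longrightarrow> u = 0"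
    and U: "totally_isotropic f U"
  shows "card U * card U \<le> CARD('a ^ 'n)"
proof -
  define P where "P = {v. \<forall>u\<in>U. f u v = 0}"
  define q where "q = int CARD('a)"
  have sub: "vec.subspace U" and iso: "U \<subseteq> P"
    using U by (auto simp: totally_isotropic_def P_def)
  have "0 \<in> U"
    using sub by (rule vec.subspace_0)
  have lin: "Vector_Spaces.linear (*s) (*) (\<lambda>v. f u v)" "Vector_Spaces.linear (*s) (*) (\<lambda>u. f u v)" for u v
    using f by (auto simp: bilinear_form_def)
  have q1: "q > 1"
    using card_mono[of UNIV "{0, 1::'a}"] by (auto simp: q_def)
  \<comment> \<open>The factor \<open>q\<close> avoids division: a nonzero \<open>u\<close>
    annihilates a hyperplane, and \<open>u = 0\<close> annihilates everything.\<close>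
  have row: "q * int (card {v. f u v = 0}) = int CARD('a ^ 'n) * (if u = 0 then q else 1)" for u
  proof (cases "u = 0")
    case True
    have "f 0 v = 0" for v
      using lin(2)[of v] by (simp add: Vector_Spaces.linear_iff) (metis mult_zero_left vec.scale_zero_left)
    then show ?thesis
      using True by simp
  next
    case False
    then obtain v where "f u v \<noteq> 0"
      using nondeg by blast
    then show ?thesis
      using card_subspace_functional[OF vec.subspace_UNIV lin(1), of v u] False by (simp add: q_def)
  qed
  have col: "q * int (card {u\<in>U. f u v = 0}) = int (card U) * (if v \<in> P then q else 1)" for v
  proof (cases "v \<in> P")
    case True
    then have "{u\<in>U. f u v = 0} = U"
      by (auto simp: P_def)
    then show ?thesis
      using True by simp
  next
    case False
    then obtain u where "u \<in> U" "f u v \<noteq> 0"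
      by (auto simp: P_def)
    then show ?thesis
      using card_subspace_functional[OF sub lin(2), of u v] False by (simp add: q_def)
  qed
  have "(\<Sum>u\<in>U. card {v. f u v = 0}) = (\<Sum>u\<in>U. \<Sum>v\<in>UNIV. if f u v = 0 then 1 else 0)"
    by (simp add: sum.If_cases)
  also have "\<dots> = (\<Sum>v\<in>UNIV. card {u\<in>U. f u v = 0})"
    by (subst sum.swap) (simp add: sum.If_cases Collect_conj_eq)
  finally have "(\<Sum>u\<in>U. q * int (card {v. f u v = 0})) = (\<Sum>v\<in>UNIV. q * int (card {u\<in>U. f u v = 0}))"
    by (simp flip: sum_distrib_left of_nat_sum)
  then have "int CARD('a ^ 'n) * (\<Sum>u\<in>U. if u = 0 then q else 1)
      = int (card U) * (\<Sum>v\<in>UNIV. if v \<in> P then q else 1)"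
    by (simp only: row col flip: sum_distrib_left)
  also have "(\<Sum>u\<in>U. if u = 0 then q else 1) = (\<Sum>u\<in>U. (if u = 0 then q - 1 else 0) + 1)"
    by (intro sum.cong) auto
  also have "\<dots> = q - 1 + int (card U)"
    using \<open>0 \<in> U\<close> by (simp add: sum.distrib)
  also have "(\<Sum>v\<in>UNIV. if v \<in> P then q else 1) = (\<Sum>v\<in>UNIV. (if v \<in> P then q - 1 else 0) + 1)"
    by (intro sum.cong) auto
  also have "\<dots> = (q - 1) * int (card P) + int CARD('a ^ 'n)"
    by (simp add: sum.distrib sum.If_cases)
  \<comment> \<open>The common term \<open>card U * CARD('a ^ 'n)\<close> of both counts cancels,
    leaving a factor \<open>q - 1 > 0\<close> on each side.\<close>
  finally have "(q - 1) * int CARD('a ^ 'n) = (q - 1) * (int (card U) * int (card P))"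
    by (simp add: algebra_simps)
  then have "int CARD('a ^ 'n) = int (card U) * int (card P)"
    using q1 by (metis diff_gt_0_iff_gt less_numeral_extra(3) mult_cancel_left)
  then have "CARD('a ^ 'n) = card U * card P"
    by (metis of_nat_eq_iff of_nat_mult)
  moreover have "card U \<le> card P"
    using iso by (intro card_mono) auto
  ultimately show ?thesis
    by simp
qed

section \<open>Descent to the small field\<close>

text \<open>Every embedded element satisfies \<open>x ^ CARD('a) = x\<close>, and both sides have
  \<open>CARD('a)\<close> elements.\<close>

lemma range_to_ac:
  assumes "even CARD('a::{field,finite})"
  shows "range (to_ac :: 'a \<Rightarrow> 'a alg_closure) = fixed_field CARD('a)"
proof -
  obtain d where "CARD('a) = 2 ^ d" "d > 0"
    using even_card_field(2)[OF assms] by blast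
  then have "finite (fixed_field CARD('a) :: 'a alg_closure set)"
    "card (fixed_field CARD('a) :: 'a alg_closure set) = CARD('a)"
    using fixed_field_card[where ?'c = "'a alg_closure"] even_card_field(1)[OF assms] by auto
  moreover have "range (to_ac :: 'a \<Rightarrow> 'a alg_closure) \<subseteq> fixed_field CARD('a)"
    by (auto simp: fixed_field_def finite_field_power_card simp flip: to_ac_power)
  moreover have "card (range (to_ac :: 'a \<Rightarrow> 'a alg_closure)) = CARD('a)"
    by (simp add: card_image inj_to_ac)
  ultimately show ?thesis
    by (intro card_subset_eq) auto
qed

theorem theorem4p5:
  fixes q m k :: nat
  assumes "CARD('a::{field,finite}) = q" and "even q"
    and "m > 0" and "k > 0" and "real m > (real k + 1) / 2"
    and "CARD('n::finite) = 4 * m * k"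
  shows "\<exists>(Q :: 'a ^ 'n \<Rightarrow> 'a) (\<Sigma> :: ('a ^ 'n) set set).
           nondegenerate_quadratic_form Q \<and> plus_type Q \<and>
           card \<Sigma> = q ^ (2 * m * k - k) + 1 \<and>
           (\<forall>U\<in>\<Sigma>. totally_singular Q U \<and> vec.dim U = 2 * m * k) \<and>
           maximal_partial_spread \<Sigma> \<and>
           orthogonal_partial_spread Q \<Sigma> \<and>
           symplectic_partial_spread (polar_form Q) \<Sigma>"
proof -
  have even: "even CARD('a)"
    using assms by simp
  have char: "CHAR('a alg_closure) = 2"
    using even_card_field(1)[OF even] by simp
  obtain d where d: "q = 2 ^ d" "d > 0"
    using even_card_field(2)[OF even] assms(1) by auto
  \<comment> \<open>Since \<open>k >= 1\<close>, the bound says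
    \<open>2 * m > k + 1 >= 2\<close>.\<close>
  have m2: "m \<ge> 2"
  proof -
    have "real (k + 1) < real (2 * m)"
      using assms(5) by (simp add: field_simps)
    then show ?thesis
      using assms(4) by (simp only: of_nat_less_iff)
  qed
  have q1: "q > 1"
    using d one_less_power[of "2::nat" d] by simp
  define r where "r = q ^ k"
  \<comment> \<open>This choice is odd, and \<open>r ^ (2 * Suc n) = q ^ (4 * m * k)\<close> is the
    required size of the ambient space.\<close>
  define n where "n = 2 * m - 1"
  have r: "r = 2 ^ (d * k)" "d * k > 0"
    using d assms(4) by (auto simp: r_def power_mult)
  have n: "odd n" "Suc n = 2 * m"
    using m2 by (auto simp: n_def)
  interpret S: orthogonal_spread r "d * k" n "fixed_field r :: 'a alg_closure set" "fixed_field (r ^ n)" "rel_trace r n"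
    by unfold_locales (use char r n in auto)

  \<comment> \<open>Coordinates over the field of order \<open>q\<close>\<close>
  define s :: "'a \<Rightarrow> 'a alg_closure \<times> 'a alg_closure \<times> 'a alg_closure \<times> 'a alg_closure \<Rightarrow> 'a alg_closure \<times> 'a alg_closure \<times> 'a alg_closure \<times> 'a alg_closure" where
    "s c = S.scale (to_ac c)" for c
  have vs: "vector_space s"
    by unfold_locales (auto simp: s_def S.scale_def algebra_simps)
  then interpret V: vector_space s .
  have to_ac_range: "range (to_ac :: 'a \<Rightarrow> 'a alg_closure) = fixed_field q"
    using range_to_ac[OF even] assms(1) by simp
  have to_ac_K: "to_ac c \<in> fixed_field r" for c :: 'a
    using to_ac_range fixed_field_mono[of q k] unfolding r_def by blast
  have "V.subspace S.space"
    unfolding V.subspace_def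
    using S.space_add S.space_scale[OF to_ac_K]
    by (simp add: s_def) (simp add: S.space_def zero_prod_def S.K_closed S.L_closed)
  moreover have card_space: "card S.space = CARD('a) ^ CARD('n)"
  proof -
    have "card S.space = r ^ (2 * Suc n)"
      unfolding S.space_def
      by (simp add: card_cartesian_product S.card_K S.card_L power_mult power2_eq_square power_mult_distrib mult_2 power_add)
    then show ?thesis
      by (simp add: n r_def assms(1,6) mult_ac flip: power_mult)
  qed
  moreover have "finite S.space"
    unfolding S.space_def using S.card_K S.card_L by auto
  ultimately obtain \<phi> :: "'a ^ 'n \<Rightarrow> 'a alg_closure \<times> 'a alg_closure \<times> 'a alg_closure \<times> 'a alg_closure"
    where \<phi>: "\<And>u v. \<phi> (u + v) = \<phi> u + \<phi> v" "\<And>c v. \<phi> (c *s v) = s c (\<phi> v)" "bij_betw \<phi> UNIV S.space"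
    using finite_subspace_coordinates[OF vs] by blast
  have \<phi>_space: "\<phi> v \<in> S.space" for v
    using \<phi>(3) by (auto simp: bij_betw_def)
  have \<phi>_inj: "\<phi> u = \<phi> v \<longleftrightarrow> u = v" for u v
    using \<phi>(3) by (auto simp: bij_betw_def inj_eq)
  have \<phi>0: "\<phi> 0 = 0"
    using \<phi>(1)[of 0 0] by simp
  have \<phi>_surj: "\<exists>v. \<phi> v = w" if "w \<in> S.space" for w
    using \<phi>(3) that by (metis bij_betw_imp_surj_on imageE)

  \<comment> \<open>The quadratic form obtained by composing with the trace\<close>
  define tr where "tr = (rel_trace q k :: 'a alg_closure \<Rightarrow> 'a alg_closure)"
  have tr: "tr 0 = 0" "tr (x + y) = tr x + tr y" "tr (to_ac c * x) = to_ac c * tr x" for x y c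
    unfolding tr_def using rel_trace_add[OF char d(1)] q1 to_ac_range
    by (auto intro!: rel_trace_smult)
  have tr_range: "tr x \<in> range to_ac" if "x \<in> fixed_field r" for x
    unfolding to_ac_range tr_def using rel_trace_in_fixed_field[OF char d(1)] that by (simp add: r_def)

  define Q where "Q v = of_ac (tr (S.form (\<phi> v)))" for v
  have Q: "to_ac (Q v) = tr (S.form (\<phi> v))" for v
    unfolding Q_def by (intro to_ac_of_ac tr_range S.form_in_K \<phi>_space)
  have polar: "to_ac (polar_form Q u v) = tr (S.polar (\<phi> u) (\<phi> v))" for u v
    by (simp add: polar_form_def Q \<phi> S.form_add_polar tr)
  have polar_commute: "polar_form Q u v = polar_form Q v u" for u v
    by (simp add: polar_form_def add.commute)
  have polar_add: "polar_form Q u (v + w) = polar_form Q u v + polar_form Q u w" for u v w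
    by (subst to_ac_eq_iff[symmetric]) (simp add: polar \<phi> S.polar_add tr)
  have polar_scale: "polar_form Q u (c *s v) = c * polar_form Q u v" for c u v
    by (subst to_ac_eq_iff[symmetric]) (simp add: polar \<phi> s_def S.polar_scale[OF to_ac_K] tr)
  have lin: "Vector_Spaces.linear (*s) (*) (\<lambda>v. polar_form Q u v)" for u
    unfolding Vector_Spaces.linear_iff
    using polar_add polar_scale vec.vector_space_axioms
    by (auto simp: vector_space_def algebra_simps)
  have bilinear: "bilinear_form (polar_form Q)"
    using lin unfolding bilinear_form_def by (simp add: polar_commute[of _ v for v])
  have "Q (c *s v) = c\<^sup>2 * Q v" for c v
    by (subst to_ac_eq_iff[symmetric])
      (simp add: Q \<phi> s_def S.form_scale[OF to_ac_K] tr power2_eq_square mult.assoc)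
  then have quadratic: "quadratic_form Q"
    using bilinear by (auto simp: quadratic_form_def)
  \<comment> \<open>Nondegeneracy of the polar form itself serves both \<open>Q\<close> and the
    symplectic form.\<close>
  have nondeg: "u = 0" if "\<And>v. polar_form Q u v = 0" for u
  proof -
    have "tr (S.polar (\<phi> u) w) = 0" if "w \<in> S.space" for w
      using \<phi>_surj[OF that] polar[of u] \<open>\<And>v. polar_form Q u v = 0\<close> by auto
    then have "\<phi> u = 0"
      using S.polar_nondegenerate[OF r_def d assms(4) \<phi>_space] by (simp add: tr_def)
    then show ?thesis
      using \<phi>_inj \<phi>0 by metis
  qed
  then have nondeg_Q: "nondegenerate_quadratic_form Q"
    using quadratic by (auto simp: nondegenerate_quadratic_form_def)
  have isotropic: "totally_isotropic (polar_form Q) U" if "totally_singular Q U" for U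
    using that vec.subspace_add[of U]
    by (auto simp: totally_singular_def totally_isotropic_def polar_form_def)

  \<comment> \<open>The pulled-back spread as a partial spread\<close>
  define \<Sigma> where "\<Sigma> = (\<lambda>S. \<phi> -` S) ` S.members"
  have image: "\<phi> ` (\<phi> -` S) = S" if "S \<in> S.members" for S
    using \<phi>(3) S.members_subset[OF that] by (auto simp: bij_betw_def)
  have card_\<Sigma>: "card \<Sigma> = q ^ (2 * m * k - k) + 1"
  proof -
    have "inj_on (\<lambda>S. \<phi> -` S) S.members"
      using image by (metis inj_onI)
    then have "card \<Sigma> = r ^ n + 1"
      by (simp add: \<Sigma>_def card_image S.card_set_members)
    moreover have "k * n = 2 * m * k - k"
      by (simp add: n_def algebra_simps diff_mult_distrib)
    ultimately show ?thesis
      by (simp add: r_def flip: power_mult)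
  qed
  have singular: "totally_singular Q U" and dim: "vec.dim U = 2 * m * k" if U: "U \<in> \<Sigma>" for U
  proof -
    obtain S where S: "S \<in> S.members" "U = \<phi> -` S"
      using U by (auto simp: \<Sigma>_def)
    have sub: "vec.subspace U"
      unfolding vec.subspace_def S(2)
      using S.zero_in_members[OF S(1)] S.members_add[OF S(1)] S.members_scale[OF S(1) _ to_ac_K]
      by (simp add: \<phi> \<phi>0 s_def)
    moreover have "Q u = 0" if "u \<in> U" for u
      using that S Q[of u] S.form_members[OF S(1)] by (simp add: tr)
    ultimately show "totally_singular Q U"
      by (simp add: totally_singular_def)
    have "card U = card S"
      using image[OF S(1)] S(2) card_image[of \<phi> U] \<phi>_inj by (simp add: inj_on_def)
    \<comment> \<open>The dimension is read off from the size \<open>r ^ Suc n\<close> of a member,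
      with \<open>Suc n = 2 * m\<close>.\<close>
    then have "q ^ vec.dim U = q ^ (2 * m * k)"
      using card_subspace_vec[OF sub] S.card_members[OF S(1)]
      by (simp add: assms(1) n r_def mult_ac flip: power_mult)
    then show "vec.dim U = 2 * m * k"
      using q1 by (simp add: power_inject_exp)
  qed
  have partial: "partial_spread \<Sigma>"
    unfolding partial_spread_def
  proof (intro conjI ballI impI)
    fix U assume "U \<in> \<Sigma>"
    then show "half_dim_subspace U"
      using singular dim assms(6) by (simp add: half_dim_subspace_def totally_singular_def)
  next
    fix U W assume "U \<in> \<Sigma>" "W \<in> \<Sigma>" "U \<noteq> W"
    then obtain S S' where "S \<in> S.members" "U = \<phi> -` S" "S' \<in> S.members" "W = \<phi> -` S'" "S \<noteq> S'"
      by (auto simp: \<Sigma>_def)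
    then have "U \<inter> W = \<phi> -` {0}"
      using S.members_disjoint by (metis vimage_Int)
    then show "U \<inter> W = {0}"
      using \<phi>_inj[of _ 0] \<phi>0 by auto
  qed
  have "\<exists>U\<in>\<Sigma>. U \<inter> W \<noteq> {0}" if W: "half_dim_subspace W" for W
  proof -
    have sub: "vec.subspace W" and "vec.dim W = 2 * m * k"
      using W assms(6) by (auto simp: half_dim_subspace_def)
    then have "card W = q ^ (2 * m * k)"
      using card_subspace_vec[OF sub] assms(1) by simp
    also have "\<dots> = 2 ^ (d * (2 * m * k))"
      by (simp add: d power_mult)
    finally have "card (\<phi> ` W) = 2 ^ (d * (2 * m * k))"
      using card_image[of \<phi> W] \<phi>_inj by (simp add: inj_on_def)
    \<comment> \<open>This is \<open>m > 1\<close> multiplied by \<open>2 * d * k\<close>: the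
      subspace is large enough for a common zero.\<close>
    moreover have "2 * (d * k) < d * (2 * m * k)"
      using m2 d(2) assms(4) by simp
    ultimately have "2 ^ (2 * (d * k)) < card (\<phi> ` W)"
      by simp
    moreover have "add_closed (\<phi> ` W)"
    proof (rule add_closedI)
      show "0 \<in> \<phi> ` W"
        using vec.subspace_0[OF sub] \<phi>0 by (metis imageI)
      show "x + y \<in> \<phi> ` W" if "x \<in> \<phi> ` W" "y \<in> \<phi> ` W" for x y
        using that vec.subspace_add[OF sub] by (auto simp flip: \<phi>(1))
    qed
    ultimately obtain w where w: "w \<in> W" "\<phi> w \<noteq> 0" "S.form (\<phi> w) = 0"
      using S.exists_singular_vector[of "\<phi> ` W"] \<phi>_space by auto
    then obtain S where "S \<in> S.members" "\<phi> w \<in> S"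
      using S.singular_in_member \<phi>_space by blast
    then have "w \<in> \<phi> -` S \<inter> W" "w \<noteq> 0" "\<phi> -` S \<in> \<Sigma>"
      using w \<phi>0 by (auto simp: \<Sigma>_def)
    then show ?thesis
      by blast
  qed
  then have maximal: "maximal_partial_spread \<Sigma>"
    using partial by (simp add: maximal_partial_spread_def)

  \<comment> \<open>Plus type and the alternating polar form\<close>
  have "witt_index Q = 2 * m * k"
    unfolding witt_index_def
  proof (rule Max_eqI)
    have "finite (range (vec.dim :: ('a ^ 'n) set \<Rightarrow> nat))"
      by simp
    then show "finite {vec.dim U | U. totally_singular Q U}"
      by (rule rev_finite_subset) auto
  next
    fix y assume "y \<in> {vec.dim U | U. totally_singular Q U}"
    then obtain U where U: "y = vec.dim U" "totally_singular Q U"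
      by blast
    then have "q ^ (2 * vec.dim U) \<le> q ^ (4 * m * k)"
      using card_isotropic_le[OF bilinear nondeg isotropic[OF U(2)]] card_subspace_vec[of U] assms(1,6)
      by (simp add: totally_singular_def card_vec mult_2 power_add)
    then show "y \<le> 2 * m * k"
      using U q1 by (simp add: power_increasing_iff mult_ac)
  next
    obtain U where "U \<in> \<Sigma>"
      using card_\<Sigma> by fastforce
    then have "totally_singular Q U" "2 * m * k = vec.dim U"
      using singular dim by simp_all
    then show "2 * m * k \<in> {vec.dim U | U. totally_singular Q U}"
      by blast
  qed
  then have plus: "plus_type Q"
    using nondeg_Q assms(6) by (simp add: plus_type_def)
  \<comment> \<open>In characteristic 2 this is \<open>Q (v + v) = Q 0\<close>, as the two copies of
    \<open>Q v\<close> cancel.\<close>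
  have "polar_form Q v v = 0" for v
  proof -
    note c2 = char2_simps[OF even_card_field(1)[OF even]]
    have "v + v = 0"
      by (simp add: vec_eq_iff c2(1))
    moreover have "Q 0 = 0"
      by (simp add: Q_def \<phi>0 S.form_def zero_prod_def S.T_simps(1) tr(1))
    ultimately show ?thesis
      unfolding polar_form_def by (simp add: c2(2,4))
  qed
  then have "symplectic_form (polar_form Q)"
    using bilinear nondeg by (auto simp: symplectic_form_def alternating_form_def)
  then show ?thesis
    using nondeg_Q plus card_\<Sigma> singular dim maximal partial isotropic
    by (intro exI[of _ Q] exI[of _ \<Sigma>])
      (simp add: orthogonal_partial_spread_def symplectic_partial_spread_def)
qed

end
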